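(* For $\delta>0$ and real $\ell<u$, let $$\mathcal C_\delta(z;\ell,u)=\ell+\operatorname{sp}_\delta(z-\ell)-\operatorname{sp}_\delta(z-u),\qquad \operatorname{sp}_\delta(q)=\delta\log(1+e^{q/\delta}),\qquad z\in\mathbb R.$$ Then for all $\delta>0$, $\ell<u$, $z,z_1,z_2\in\mathbb R$ and $\lambda>0$: (1) $\ell<\mathcal C_\delta(z;\ell,u)<u$ and $0<\partial_z\mathcal C_\delta(z;\ell,u)<1$; (2) $|\mathcal C_\delta(z_1;\ell,u)-\mathcal C_\delta(z_2;\ell,u)|\le|z_1-z_2|$; (3) $|\mathcal C_\delta(z;\ell,u)-P_{[\ell,u]}(z)|\le\delta\log2$; (4) $\mathcal C_{\lambda\delta}(\lambda z;\lambda\ell,\lambda u)=\lambda\,\mathcal C_\delta(z;\ell,u)$; (5) for every $v\in[\ell,u]$, $|\mathcal C_\delta(z;\ell,u)-v|\le|z-v|+\delta\log2$.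
   Context: $P_{[\ell,u]}(z)=\min(\max(z,\ell),u)$ denotes the projection of $z\in\mathbb R$ onto the interval $[\ell,u]$. *)

theory Defs
  imports "HOL-Analysis.Analysis"
begin

definition softplus :: "real \<Rightarrow> real \<Rightarrow> real" where
  "softplus \<delta> q = \<delta> * ln (1 + exp (q / \<delta>))"

definition soft_clip :: "real \<Rightarrow> real \<Rightarrow> real \<Rightarrow> real \<Rightarrow> real" where
  "soft_clip \<delta> z l u = l + softplus \<delta> (z - l) - softplus \<delta> (z - u)"

definition interval_proj :: "real \<Rightarrow> real \<Rightarrow> real \<Rightarrow> real" where
  "interval_proj l u z = min (max z l) u"

end

theory Submission
  imports Defs
begin

text \<open>Softplus exceeds the positive part by an error in \<open>(0, \<delta> log 2]\<close>, and the
  projection is the same combination of positive parts as the soft clip is of softplus terms;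
  so the approximation error is a difference of two numbers in that interval.  The derivative
  of the soft clip is a difference of two values of the increasing logistic function, which
  takes values in \<open>(0, 1)\<close>; this gives the Lipschitz bound.\<close>

text \<open>Factor \<open>exp (q / \<delta>)\<close> out of \<open>1 + exp (q / \<delta>)\<close>:
  its logarithm contributes the linear term. This reflection turns lower bounds into upper
  ones.\<close>

lemma softplus_minus:
  assumes "\<delta> > 0"
  shows "softplus \<delta> (- q) = softplus \<delta> q - q"
proof -
  have "1 + exp (q / \<delta>) = exp (q / \<delta>) * (1 + exp (- q / \<delta>))"
    by (simp add: distrib_left flip: exp_add)
  moreover have "1 + exp (- q / \<delta>) > 0"
    by (intro add_pos_pos) auto
  ultimately have "ln (1 + exp (q / \<delta>)) = q / \<delta> + ln (1 + exp (- q / \<delta>))"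
    by (metis exp_gt_zero ln_exp ln_mult_pos)
  then show ?thesis
    using assms by (simp add: softplus_def distrib_left)
qed

lemma softplus_strict_mono:
  assumes "\<delta> > 0" and "p < q"
  shows "softplus \<delta> p < softplus \<delta> q"
proof -
  have "exp (p / \<delta>) < exp (q / \<delta>)"
    using assms by (simp add: divide_strict_right_mono)
  then have "ln (1 + exp (p / \<delta>)) < ln (1 + exp (q / \<delta>))"
    by (subst ln_less_cancel_iff) (auto intro: add_pos_pos)
  with assms show ?thesis
    by (simp add: softplus_def)
qed

lemma softplus_pos:
  assumes "\<delta> > 0"
  shows "softplus \<delta> q > 0"
  unfolding softplus_def using assms by (intro mult_pos_pos ln_gt_zero) auto

lemma softplus_minus_pos_part_bounds:
  assumes "\<delta> > 0"
  shows "0 < softplus \<delta> q - max q 0" and "softplus \<delta> q - max q 0 \<le> \<delta> * ln 2"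
proof -
  \<comment> \<open>The error is even in \<open>q\<close>: reflection settles
    \<open>q \<ge> 0\<close>, and for \<open>q < 0\<close> the positive part vanishes. Only
    arguments up to 0 remain, where softplus is positive and largest at 0.\<close>
  have eq: "softplus \<delta> q - max q 0 = softplus \<delta> (- \<bar>q\<bar>)"
    using softplus_minus[OF assms, of q] by (cases "q \<ge> 0") auto
  show "0 < softplus \<delta> q - max q 0"
    unfolding eq by (rule softplus_pos[OF assms])
  have "softplus \<delta> (- \<bar>q\<bar>) \<le> softplus \<delta> 0"
    using softplus_strict_mono[OF assms, of "- \<bar>q\<bar>" 0] by (cases "q = 0") auto
  also have "\<dots> = \<delta> * ln 2"
    by (simp add: softplus_def)
  finally show "softplus \<delta> q - max q 0 \<le> \<delta> * ln 2"
    unfolding eq .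
qed

lemma soft_clip_bounds:
  assumes "\<delta> > 0" and "l < u"
  shows "l < soft_clip \<delta> z l u" and "soft_clip \<delta> z l u < u"
proof -
  show "l < soft_clip \<delta> z l u"
    using softplus_strict_mono[OF assms(1), of "z - u" "z - l"] assms(2)
    by (simp add: soft_clip_def)
  \<comment> \<open>Reflecting both arguments in \<open>l - z < u - z\<close> adds the linear terms,
    so the difference of softplus values is less than
    \<open>(z - l) - (z - u) = u - l\<close>.\<close>
  show "soft_clip \<delta> z l u < u"
    using softplus_strict_mono[OF assms(1), of "- (z - l)" "- (z - u)"] assms(2)
    unfolding softplus_minus[OF assms(1)] by (simp add: soft_clip_def)
qed

text \<open>The derivative is the logistic function of \<open>q / \<delta>\<close>, written as 1
  minus a reciprocal so that the 1s cancel in the derivative of the soft clip.\<close>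

lemma softplus_has_real_derivative:
  assumes "\<delta> > 0"
  shows "(softplus \<delta> has_real_derivative 1 - 1 / (1 + exp (q / \<delta>))) (at q)"
proof -
  have pos: "1 + exp (q / \<delta>) > 0"
    by (simp add: add_pos_pos)
  then have "1 - 1 / (1 + exp (q / \<delta>)) = \<delta> * (exp (q / \<delta>) * (1 / \<delta>) / (1 + exp (q / \<delta>)))"
    using assms by (simp add: divide_simps)
  with pos show ?thesis
    unfolding softplus_def[abs_def] using assms
    by (auto intro!: derivative_eq_intros)
qed

lemma soft_clip_has_real_derivative:
  assumes "\<delta> > 0"
  shows "((\<lambda>x. soft_clip \<delta> x l u) has_real_derivative
           1 / (1 + exp ((z - u) / \<delta>)) - 1 / (1 + exp ((z - l) / \<delta>))) (at z)"
  unfolding soft_clip_def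
  by (auto intro!: derivative_eq_intros
      DERIV_chain2[OF softplus_has_real_derivative[OF assms]])

lemma logistic_difference_bounds:
  fixes a b :: real
  assumes "a < b"
  shows "0 < 1 / (1 + exp a) - 1 / (1 + exp b)" and "1 / (1 + exp a) - 1 / (1 + exp b) < 1"
proof -
  have "1 / (1 + exp b) < 1 / (1 + exp a)"
    using assms by (intro divide_strict_left_mono) (auto intro!: mult_pos_pos add_pos_pos)
  then show "0 < 1 / (1 + exp a) - 1 / (1 + exp b)"
    by simp
  have "1 / (1 + exp a) < 1" "0 < 1 / (1 + exp b)"
    by (auto simp: add_pos_pos)
  then show "1 / (1 + exp a) - 1 / (1 + exp b) < 1"
    by linarith
qed

lemma deriv_soft_clip_bounds:
  assumes "\<delta> > 0" and "l < u"
  shows "0 < deriv (\<lambda>x. soft_clip \<delta> x l u) z" and "deriv (\<lambda>x. soft_clip \<delta> x l u) z < 1"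
proof -
  have "(z - u) / \<delta> < (z - l) / \<delta>"
    using assms by (simp add: divide_strict_right_mono)
  from logistic_difference_bounds[OF this]
  show "0 < deriv (\<lambda>x. soft_clip \<delta> x l u) z" and "deriv (\<lambda>x. soft_clip \<delta> x l u) z < 1"
    unfolding DERIV_imp_deriv[OF soft_clip_has_real_derivative[OF assms(1)]] .
qed

text \<open>\<open>deriv\<close> is a total operator, so bounds on its value do not by themselves
  assert that a derivative exists.\<close>

lemma soft_clip_field_differentiable:
  assumes "\<delta> > 0"
  shows "(\<lambda>x. soft_clip \<delta> x l u) field_differentiable (at z)"
  using soft_clip_has_real_derivative[OF assms] field_differentiable_def by blast

lemma soft_clip_nonexpansive:
  assumes "\<delta> > 0" and "l < u"
  shows "\<bar>soft_clip \<delta> z1 l u - soft_clip \<delta> z2 l u\<bar> \<le> \<bar>z1 - z2\<bar>"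
proof -
  let ?f = "\<lambda>x. soft_clip \<delta> x l u"
  have "norm (?f z1 - ?f z2) \<le> 1 * norm (z1 - z2)"
  \<comment> \<open>Mean value inequality on the convex set \<open>UNIV\<close>, with derivative
    bound 1.\<close>
  proof (rule field_differentiable_bound[of UNIV ?f "deriv ?f"])
    fix x
    show "(?f has_field_derivative deriv ?f x) (at x within UNIV)"
      using soft_clip_field_differentiable[OF assms(1)] by (simp add: DERIV_deriv_iff_field_differentiable)
    show "norm (deriv ?f x) \<le> 1"
      using deriv_soft_clip_bounds[OF assms, of x] by simp
  qed auto
  then show ?thesis
    by simp
qed

text \<open>Above \<open>u\<close> both positive parts are active and \<open>z\<close> cancels,
  leaving \<open>u\<close>; the shape matches \<open>soft_clip_def\<close> term by term.\<close>

lemma interval_proj_eq_pos_parts: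
  assumes "l \<le> u"
  shows "interval_proj l u z = l + max (z - l) 0 - max (z - u) 0"
  using assms by (auto simp: interval_proj_def min_def max_def)

lemma soft_clip_minus_interval_proj:
  assumes "\<delta> > 0" and "l \<le> u"
  shows "\<bar>soft_clip \<delta> z l u - interval_proj l u z\<bar> \<le> \<delta> * ln 2"
  using softplus_minus_pos_part_bounds[OF assms(1), of "z - l"]
    softplus_minus_pos_part_bounds[OF assms(1), of "z - u"]
  unfolding interval_proj_eq_pos_parts[OF assms(2)] soft_clip_def by linarith

text \<open>A point outside the interval moves towards \<open>v\<close> when projected and does not
  pass it.\<close>

lemma interval_proj_dist_le:
  assumes "v \<in> {l..u}"
  shows "\<bar>interval_proj l u z - v\<bar> \<le> \<bar>z - v\<bar>"
  using assms by (auto simp: interval_proj_def min_def max_def)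

text \<open>The quotient \<open>q / \<delta>\<close> is invariant under common scaling, so only the
  prefactor changes.\<close>

lemma softplus_scale:
  assumes "c \<noteq> 0"
  shows "softplus (c * \<delta>) (c * q) = c * softplus \<delta> q"
  using assms by (simp add: softplus_def)

lemma soft_clip_scale:
  assumes "c \<noteq> 0"
  shows "soft_clip (c * \<delta>) (c * z) (c * l) (c * u) = c * soft_clip \<delta> z l u"
  using softplus_scale[OF assms, of \<delta> "z - l"] softplus_scale[OF assms, of \<delta> "z - u"]
  by (simp add: soft_clip_def algebra_simps)

theorem propositionA2:
  fixes \<delta> l u z z1 z2 c :: real
  assumes "\<delta> > 0" and "l < u" and "c > 0"
  shows "(l < soft_clip \<delta> z l u \<and> soft_clip \<delta> z l u < u
           \<and> (\<lambda>x. soft_clip \<delta> x l u) field_differentiable (at z)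
           \<and> 0 < deriv (\<lambda>x. soft_clip \<delta> x l u) z
           \<and> deriv (\<lambda>x. soft_clip \<delta> x l u) z < 1)
       \<and> \<bar>soft_clip \<delta> z1 l u - soft_clip \<delta> z2 l u\<bar> \<le> \<bar>z1 - z2\<bar>
       \<and> \<bar>soft_clip \<delta> z l u - interval_proj l u z\<bar> \<le> \<delta> * ln 2
       \<and> soft_clip (c * \<delta>) (c * z) (c * l) (c * u) = c * soft_clip \<delta> z l u
       \<and> (\<forall>v\<in>{l..u}. \<bar>soft_clip \<delta> z l u - v\<bar> \<le> \<bar>z - v\<bar> + \<delta> * ln 2)"
proof (intro conjI ballI)
  show "l < soft_clip \<delta> z l u" and "soft_clip \<delta> z l u < u"
    using soft_clip_bounds[OF assms(1,2)] .
  show "(\<lambda>x. soft_clip \<delta> x l u) field_differentiable (at z)"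
    by (rule soft_clip_field_differentiable[OF assms(1)])
  show "0 < deriv (\<lambda>x. soft_clip \<delta> x l u) z" and "deriv (\<lambda>x. soft_clip \<delta> x l u) z < 1"
    using deriv_soft_clip_bounds[OF assms(1,2)] .
  show "\<bar>soft_clip \<delta> z1 l u - soft_clip \<delta> z2 l u\<bar> \<le> \<bar>z1 - z2\<bar>"
    by (rule soft_clip_nonexpansive[OF assms(1,2)])
  show approx: "\<bar>soft_clip \<delta> z l u - interval_proj l u z\<bar> \<le> \<delta> * ln 2"
    using assms by (intro soft_clip_minus_interval_proj) auto
  show "soft_clip (c * \<delta>) (c * z) (c * l) (c * u) = c * soft_clip \<delta> z l u"
    using assms by (intro soft_clip_scale) auto
  show "\<bar>soft_clip \<delta> z l u - v\<bar> \<le> \<bar>z - v\<bar> + \<delta> * ln 2" if "v \<in> {l..u}" for v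
    \<comment> \<open>Triangle inequality through the projection of \<open>z\<close>.\<close>
    using approx interval_proj_dist_le[OF that, of z] by linarith
qed

end
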